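(* Let $\mathcal{F}$ be a filtration of a simplicial complex $K$ and let $L=\bigcup_{i=1}^t \mathrm{st}(\tau_i)$, where $\{\tau_1,\dots,\tau_t\}\subseteq K$ is a set of simplices to be removed from $\mathcal{F}$. If the algorithm SiRUP is run on input $(R',V',L)$, where $R'$ is a reduced matrix and $V'$ an operations matrix for $\mathcal{F}$, then its output $(R,V)$ is a reduced matrix and operations matrix for $\mathcal{F}\setminus L$.
   Context: All matrices have entries in $\mathbb{Z}_2$. A simplicial complex is a finite set of nonempty finite sets (simplices) closed under nonempty subsets. The star of $\sigma\in K$ is $\mathrm{st}(\sigma)=\{\tau\in K : \sigma\subseteq\tau\}$. Filtrations are simplex-wise: a filtration $\mathcal{F}$ of $K$ is given by an ordering $\sigma_1,\dots,\sigma_n$ of the simplices of $K$ respecting the face relation (if $\sigma_i\subseteq\sigma_j$ then $i\le j$), with $K_i=\{\sigma_1,\dots,\sigma_i\}$. Its boundary matrix $D$ is the $n\times n$ matrix with $D[i,j]=1$ if $\sigma_i$ is a facet (codimension-one face) of $\sigma_j$, and $0$ otherwise. $\mathcal{F}\setminus L$ denotes the filtration $\mathcal{F}$ without the simplices in $L$, i.e. the filtration of $K\setminus L$ in which the remaining simplices keep their relative order; its boundary matrix is $D$ with the rows and columns of the simplices in $L$ deleted. Rows and columns keep the labels of their simplices after deletions. $M[i]$ is the $i$-th column of $M$; $M[i,j]$ is the $i$-th entry of its $j$-th column. $\mathrm{piv}(M[i])$ is the row index of the lowest (largest row index) nonzero entry of $M[i]$; a zero column has pivot $-1$. A matrix is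 reduced if all its nonzero columns have different pivots. A reduced matrix $R$ and operations matrix $V$ for a filtration with boundary matrix $D$: $R$ is a reduced matrix obtained from $D$ by column additions, and $V$ is the matrix that keeps track of the column operations used to reduce $D$ to $R$, so that $R=DV$. The matrix $V$ is not required to be upper triangular. (One such pair is the output of the standard barcode algorithm: starting from $R=D$ and $V$ the identity matrix, for $j=1,\dots,n$, while there is $j'<j$ with $R[j']$ and $R[j]$ nonzero and having the same pivot, add column $j'$ to column $j$ in both $R$ and $V$.) Algorithm SiRUP. Input: $R'$, $V'$, list $L$. Set $R\leftarrow R'$, $V\leftarrow V'$. For each $\sigma_j\in L$, in turn, do the following. (1) Let $A=\{i : V[j,i]\neq 0,\ i\neq j\}=\{A_1,A_2,\dots\}$ in increasing order. (2) Put $A_0=j$ and let $B=\{A_0\}\cup\{A_i\in A : \mathrm{piv}(R[A_i])<\mathrm{piv}(R[A_t])\text{ for all } t<i\}$, listed in increasing order and indexed from $0$, as $B_0=j,B_1,B_2,\dots$. (3) For each $i\in A$ in decreasing order: let $k$ be the smallest index such that $\mathrm{piv}(R[B_k])\le \mathrm{piv}(R[i])$; if $i=B_k$, replace $k$ by $k-1$; add column $B_k$ to column $i$ in $R$ and in $V$. (4) Delete columns $R[j]$ and $V[j]$, and row $j$ in $R$ and in $V$. Return $R$, $V$.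
   Formalization: It is additionally assumed that whenever SiRUP processes σ_j in L, the current V has V[j,j] ≠ 0 (automatic for upper triangular V' with nonzero diagonal); without this, for non-triangular V', R = DV can fail. *)

theory Defs
  imports "HOL-Library.Z2"
begin

definition simplicial_complex :: "'v set set \<Rightarrow> bool" where
  "simplicial_complex K \<longleftrightarrow>
     finite K \<and> (\<forall>\<sigma>\<in>K. finite \<sigma> \<and> \<sigma> \<noteq> {}) \<and>
     (\<forall>\<sigma>\<in>K. \<forall>\<tau>. \<tau> \<subseteq> \<sigma> \<and> \<tau> \<noteq> {} \<longrightarrow> \<tau> \<in> K)"

definition star :: "'v set set \<Rightarrow> 'v set \<Rightarrow> 'v set set" where
  "star K \<sigma> = {\<tau> \<in> K. \<sigma> \<subseteq> \<tau>}"

definition is_facet :: "'v set \<Rightarrow> 'v set \<Rightarrow> bool" where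
  "is_facet \<tau> \<sigma> \<longleftrightarrow> \<tau> \<subseteq> \<sigma> \<and> card \<sigma> = card \<tau> + 1"

text \<open>A filtration is a finite set \<open>I\<close> of labels together with the simplices \<open>\<sigma> i\<close> that they
  name. The filtrations one starts from have \<open>I = {1..n}\<close>; since the labels of the remaining
  simplices are kept, removing simplices only shrinks \<open>I\<close>.\<close>

definition filtration :: "'v set set \<Rightarrow> nat set \<Rightarrow> (nat \<Rightarrow> 'v set) \<Rightarrow> bool" where
  "filtration K I \<sigma> \<longleftrightarrow>
     finite I \<and> bij_betw \<sigma> I K \<and> (\<forall>i\<in>I. \<forall>j\<in>I. \<sigma> i \<subseteq> \<sigma> j \<longrightarrow> i \<le> j)"

definition labels_without :: "nat set \<Rightarrow> (nat \<Rightarrow> 'v set) \<Rightarrow> 'v set set \<Rightarrow> nat set" where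
  "labels_without I \<sigma> L = {i \<in> I. \<sigma> i \<notin> L}"

text \<open>\<open>M i j\<close> is the entry in row \<open>i\<close> and column \<open>j\<close>. A matrix whose rows and columns are labelled
  by \<open>I\<close> is represented by a function that vanishes outside \<open>I \<times> I\<close>; accordingly, a row or
  column is deleted by setting it to zero while its label leaves \<open>I\<close>.\<close>

type_synonym z2_matrix = "nat \<Rightarrow> nat \<Rightarrow> bit"

definition boundary_matrix :: "nat set \<Rightarrow> (nat \<Rightarrow> 'v set) \<Rightarrow> z2_matrix" where
  "boundary_matrix I \<sigma> =
     (\<lambda>i j. if i \<in> I \<and> j \<in> I \<and> is_facet (\<sigma> i) (\<sigma> j) then 1 else 0)"

definition identity_matrix :: "nat set \<Rightarrow> z2_matrix" where
  "identity_matrix I = (\<lambda>i j. if i \<in> I \<and> i = j then 1 else 0)"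

definition piv :: "z2_matrix \<Rightarrow> nat \<Rightarrow> int" where
  "piv M c = (if \<forall>r. M r c = 0 then -1 else int (Max {r. M r c \<noteq> 0}))"

definition reduced :: "nat set \<Rightarrow> z2_matrix \<Rightarrow> bool" where
  "reduced I M \<longleftrightarrow>
     (\<forall>c\<in>I. \<forall>d\<in>I. (\<exists>r. M r c \<noteq> 0) \<and> (\<exists>r. M r d \<noteq> 0) \<and> c \<noteq> d \<longrightarrow> piv M c \<noteq> piv M d)"

text \<open>\<open>add_column k i M\<close> adds column \<open>k\<close> to column \<open>i\<close>.\<close>

definition add_column :: "nat \<Rightarrow> nat \<Rightarrow> z2_matrix \<Rightarrow> z2_matrix" where
  "add_column k i M = (\<lambda>r c. if c = i then M r i + M r k else M r c)"

definition delete_column :: "nat \<Rightarrow> z2_matrix \<Rightarrow> z2_matrix" where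
  "delete_column j M = (\<lambda>r c. if c = j then 0 else M r c)"

definition delete_row :: "nat \<Rightarrow> z2_matrix \<Rightarrow> z2_matrix" where
  "delete_row j M = (\<lambda>r c. if r = j then 0 else M r c)"

text \<open>\<open>column_ops I D R V\<close>: some sequence of column additions turns \<open>D\<close> into \<open>R\<close>, and \<open>V\<close> records
  it. The additions may go in either direction, so \<open>V\<close> need not be upper triangular.\<close>

inductive column_ops :: "nat set \<Rightarrow> z2_matrix \<Rightarrow> z2_matrix \<Rightarrow> z2_matrix \<Rightarrow> bool"
  for I :: "nat set" and D :: z2_matrix where
  start: "column_ops I D D (identity_matrix I)"
| add: "column_ops I D R V \<Longrightarrow> k \<in> I \<Longrightarrow> i \<in> I \<Longrightarrow> k \<noteq> i \<Longrightarrow>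
        column_ops I D (add_column k i R) (add_column k i V)"

definition reduced_and_operations_matrix ::
  "nat set \<Rightarrow> (nat \<Rightarrow> 'v set) \<Rightarrow> z2_matrix \<Rightarrow> z2_matrix \<Rightarrow> bool" where
  "reduced_and_operations_matrix I \<sigma> R V \<longleftrightarrow>
     column_ops I (boundary_matrix I \<sigma>) R V \<and> reduced I R"

lemma column_ops_product:
  assumes "column_ops I D R V" "finite I" "\<And>r c. c \<notin> I \<Longrightarrow> D r c = 0"
  shows "R r c = (\<Sum>m\<in>I. D r m * V m c)"
  using assms(1)
proof (induction arbitrary: r c)
  case start
  have "(\<Sum>m\<in>I. D r m * identity_matrix I m c) = (\<Sum>m\<in>I. if m = c then D r m else 0)"
    by (rule sum.cong) (auto simp: identity_matrix_def)
  then show ?case using assms(2,3) by simp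
next
  case (add R V k i)
  then show ?case by (simp add: add_column_def sum.distrib distrib_left del: add_bit_eq_xor mult_bit_eq_and)
qed

definition sirup_A :: "z2_matrix \<Rightarrow> nat \<Rightarrow> nat list" where
  "sirup_A V j = sorted_list_of_set {i. V j i \<noteq> 0 \<and> i \<noteq> j}"

text \<open>Position \<open>0\<close> of the list \<open>j # sirup_A V j\<close> holds \<open>A\<^sub>0 = j\<close>, which always enters the result,
  so that \<open>B\<^sub>0 = j\<close> even if \<open>A\<close> contains labels smaller than \<open>j\<close>.\<close>

definition sirup_B :: "z2_matrix \<Rightarrow> z2_matrix \<Rightarrow> nat \<Rightarrow> nat list" where
  "sirup_B R V j = (let As = j # sirup_A V j in
     map ((!) As)
       (filter (\<lambda>i. \<forall>t<i. piv R (As ! i) < piv R (As ! t)) [0..<length As]))"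

definition sirup_add ::
  "nat list \<Rightarrow> nat \<Rightarrow> z2_matrix \<times> z2_matrix \<Rightarrow> z2_matrix \<times> z2_matrix" where
  "sirup_add Bs i = (\<lambda>(R, V).
     let k = (LEAST k. k < length Bs \<and> piv R (Bs ! k) \<le> piv R i);
         b = (if i = Bs ! k then Bs ! (k - 1) else Bs ! k)
     in (add_column b i R, add_column b i V))"

definition sirup_step :: "nat \<Rightarrow> z2_matrix \<times> z2_matrix \<Rightarrow> z2_matrix \<times> z2_matrix" where
  "sirup_step j = (\<lambda>(R, V).
     let (R1, V1) = fold (sirup_add (sirup_B R V j)) (rev (sirup_A V j)) (R, V)
     in (delete_row j (delete_column j R1), delete_row j (delete_column j V1)))"

definition sirup :: "z2_matrix \<Rightarrow> z2_matrix \<Rightarrow> nat list \<Rightarrow> z2_matrix \<times> z2_matrix" where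
  "sirup R V js = fold sirup_step js (R, V)"

text \<open>The algorithm clears row \<open>j\<close> of \<open>V\<close> by adding columns \<open>B\<^sub>k\<close> to the columns in \<open>A\<close>, which
  works only if every \<open>B\<^sub>k\<close>, including \<open>B\<^sub>0 = j\<close>, has a nonzero entry in that row. So \<open>V j j \<noteq> 0\<close>
  is needed when \<open>j\<close> is processed; otherwise \<open>R = D V\<close> can be lost. This does not ask \<open>V\<close> to be
  upper triangular, and it always holds if \<open>V\<close> is upper triangular with nonzero diagonal
  entries (\<open>sirup_applicable_upper_triangular\<close> below).\<close>

definition sirup_applicable :: "z2_matrix \<Rightarrow> z2_matrix \<Rightarrow> nat list \<Rightarrow> bool" where
  "sirup_applicable R V js \<longleftrightarrow>
     (\<forall>us j vs. js = us @ j # vs \<longrightarrow> snd (sirup R V us) j j \<noteq> 0)"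

lemma sirup_A_props:
  assumes "\<And>r c. V r c \<noteq> 0 \<Longrightarrow> r \<le> c"
  shows "sorted_wrt (<) (j # sirup_A V j)"
proof -
  have "set (sirup_A V j) \<subseteq> {i. V j i \<noteq> 0 \<and> i \<noteq> j}"
    by (cases "finite {i. V j i \<noteq> 0 \<and> i \<noteq> j}") (auto simp: sirup_A_def)
  then have "\<forall>i\<in>set (sirup_A V j). j < i"
    using assms[of j] by (metis (mono_tags, lifting) le_neq_implies_less mem_Collect_eq subsetD)
  then show ?thesis
    by (simp add: sirup_A_def)
qed

lemma sirup_B_below:
  assumes "m < length (j # sirup_A V j)"
  shows "\<exists>t\<le>m. (j # sirup_A V j) ! t \<in> set (sirup_B R V j) \<and>
           piv R ((j # sirup_A V j) ! t) \<le> piv R ((j # sirup_A V j) ! m)"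
  using assms
proof (induction m rule: less_induct)
  case (less m)
  let ?As = "j # sirup_A V j"
  show ?case
  proof (cases "\<forall>t<m. piv R (?As ! m) < piv R (?As ! t)")
    case True
    then have "?As ! m \<in> set (sirup_B R V j)"
      using less.prems unfolding sirup_B_def Let_def set_map set_filter
      by (intro imageI) (simp del: upt_Suc)
    then show ?thesis by blast
  next
    case False
    then obtain s where "s < m" "piv R (?As ! s) \<le> piv R (?As ! m)"
      by (meson not_less)
    moreover obtain t where "t \<le> s" "?As ! t \<in> set (sirup_B R V j)"
        "piv R (?As ! t) \<le> piv R (?As ! s)"
      using less.IH[of s] less.prems \<open>s < m\<close> less_trans by blast
    ultimately show ?thesis
      by (intro exI[of _ t]) linarith
  qed
qed

lemma sirup_B_sorted:
  assumes "sorted_wrt (<) (j # sirup_A V j)"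
  shows "sorted_wrt (<) (sirup_B R V j)"
proof -
  let ?As = "j # sirup_A V j"
  have "sorted_wrt (\<lambda>x y. ?As ! x < ?As ! y)
          (filter (\<lambda>i. \<forall>t<i. piv R (?As ! i) < piv R (?As ! t)) [0..<length ?As])"
    using sorted_wrt_nth_less[OF assms]
    by (intro sorted_wrt_filter) (simp add: sorted_wrt_iff_nth_less del: upt_Suc)
  then show ?thesis
    unfolding sirup_B_def Let_def sorted_wrt_map .
qed

lemma sirup_B_0: "sirup_B R V j \<noteq> []" "sirup_B R V j ! 0 = j"
  unfolding sirup_B_def Let_def by (simp_all add: upt_conv_Cons del: upt_Suc)

lemma sirup_add_from_left:
  assumes srt: "sorted_wrt (<) (j # sirup_A V0 j)" and i: "i \<in> set (sirup_A V0 j)"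
    and R: "\<And>r c. c \<le> i \<Longrightarrow> R r c = R0 r c"
  obtains b where "b < i"
    "sirup_add (sirup_B R0 V0 j) i (R, V) = (add_column b i R, add_column b i V)"
proof -
  let ?As = "j # sirup_A V0 j" and ?Bs = "sirup_B R0 V0 j"
  have piv_eq: "piv R c = piv R0 c" if "c \<le> i" for c
    using R[OF that] by (simp add: piv_def)
  obtain m where m: "m < length ?As" "?As ! m = i"
    using i by (metis in_set_conv_nth list.set_intros(2))
  obtain t where t: "t \<le> m" "?As ! t \<in> set ?Bs" "piv R0 (?As ! t) \<le> piv R0 i"
    using sirup_B_below[OF m(1), of R0] m(2) by auto
  have "?As ! t \<le> i"
    using sorted_wrt_nth_less[OF srt] t(1) m by (metis le_eq_less_or_eq)
  moreover obtain k0 where k0: "k0 < length ?Bs" "?Bs ! k0 = ?As ! t"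
    using t(2) by (metis in_set_conv_nth)
  ultimately have k0': "?Bs ! k0 \<le> i" "piv R (?Bs ! k0) \<le> piv R i"
    using t(3) piv_eq by simp_all
  define k where "k = (LEAST k. k < length ?Bs \<and> piv R (?Bs ! k) \<le> piv R i)"
  have k: "k \<le> k0"
    unfolding k_def using k0 k0' by (intro Least_le) simp
  have Bs: "?Bs ! x < ?Bs ! y" if "x < y" "y < length ?Bs" for x y
    using sorted_wrt_nth_less[OF sirup_B_sorted[OF srt] that] .
  have "?Bs ! k \<le> i"
    using Bs[of k k0] k k0(1) k0'(1) by (cases "k = k0") auto
  moreover have "?Bs ! (k - 1) < ?Bs ! k" if "i = ?Bs ! k"
  proof -
    have "k \<noteq> 0" using that i srt sirup_B_0(2)[of R0 V0 j] by (metis less_irrefl sorted_wrt.simps(2))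
    then show ?thesis using Bs[of "k - 1" k] k k0(1) by simp
  qed
  ultimately have "(if i = ?Bs ! k then ?Bs ! (k - 1) else ?Bs ! k) < i"
    by (auto split: if_splits)
  then show ?thesis
    using that unfolding sirup_add_def k_def Let_def by fastforce
qed

lemma sirup_step_upper_triangular:
  assumes ut: "\<And>r c. V r c \<noteq> 0 \<Longrightarrow> r \<le> c"
    and step: "sirup_step j (R, V) = (R', V')"
  shows "V' r c \<noteq> 0 \<Longrightarrow> r \<le> c" and "r \<noteq> j \<Longrightarrow> V' r r = V r r"
proof -
  let ?f = "sirup_add (sirup_B R V j)"
  note srt = sirup_A_props[of V j, OF ut]
  have fold: "(\<forall>r c. V1 r c \<noteq> 0 \<longrightarrow> r \<le> c) \<and> (\<forall>r. V1 r r = V r r)"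
    if "fold ?f xs (R2, V2) = (R1, V1)" "sorted_wrt (>) xs" "set xs \<subseteq> set (sirup_A V j)"
      "\<forall>i\<in>set xs. \<forall>r. \<forall>c\<le>i. R2 r c = R r c"
      "\<forall>r c. V2 r c \<noteq> 0 \<longrightarrow> r \<le> c" "\<forall>r. V2 r r = V r r" for xs R2 V2 R1 V1
    using that
  proof (induction xs arbitrary: R2 V2)
    case Nil
    then show ?case by simp
  next
    case (Cons i xs)
    obtain b where b: "b < i" "?f i (R2, V2) = (add_column b i R2, add_column b i V2)"
      using sirup_add_from_left[OF srt, of i R2 R V2] Cons.prems(3,4) by auto
    have b0: "V2 i b = 0"
      using Cons.prems(5) b(1) by (meson not_le)
    show ?case
    proof (rule Cons.IH)
      show "fold ?f xs (add_column b i R2, add_column b i V2) = (R1, V1)"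
        using Cons.prems(1) b(2) by simp
      show "\<forall>r c. add_column b i V2 r c \<noteq> 0 \<longrightarrow> r \<le> c"
      proof (intro allI impI)
        fix r c assume nz: "add_column b i V2 r c \<noteq> 0"
        have "V2 r c \<noteq> 0 \<or> c = i \<and> V2 r b \<noteq> 0"
        proof (rule ccontr)
          assume "\<not> ?thesis"
          then show False using nz by (simp add: add_column_def split: if_splits)
        qed
        then show "r \<le> c"
          using Cons.prems(5) b(1) by (meson le_trans less_imp_le)
      qed
      show "\<forall>r. add_column b i V2 r r = V r r"
        using Cons.prems(6) b0 by (simp add: add_column_def)
      show "sorted_wrt (>) xs" "set xs \<subseteq> set (sirup_A V j)"
        using Cons.prems(2,3) by simp_all
      show "\<forall>i'\<in>set xs. \<forall>r. \<forall>c\<le>i'. add_column b i R2 r c = R r c"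
      proof (intro ballI allI impI)
        fix i' r c assume "i' \<in> set xs" "c \<le> i'"
        moreover from this have "i' < i"
          using Cons.prems(2) by simp
        ultimately show "add_column b i R2 r c = R r c"
          using Cons.prems(4) unfolding add_column_def
          by (metis le_antisym less_imp_le list.set_intros(2) not_less)
      qed
    qed
  qed
  obtain R1 V1 where RV1: "fold ?f (rev (sirup_A V j)) (R, V) = (R1, V1)"
    by fastforce
  have V': "V' = delete_row j (delete_column j V1)"
    using step RV1 by (simp add: sirup_step_def)
  have V1: "(\<forall>r c. V1 r c \<noteq> 0 \<longrightarrow> r \<le> c) \<and> (\<forall>r. V1 r r = V r r)"
  proof (rule fold[OF RV1])
    show "sorted_wrt (>) (rev (sirup_A V j))"
      using srt by (simp add: sorted_wrt_rev)
    show "\<forall>r c. V r c \<noteq> 0 \<longrightarrow> r \<le> c"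
      using ut by blast
  qed simp_all
  show "r \<le> c" if "V' r c \<noteq> 0"
  proof -
    have "V1 r c \<noteq> 0"
      using that unfolding V' delete_row_def delete_column_def by metis
    then show ?thesis using V1 by blast
  qed
  show "V' r r = V r r" if "r \<noteq> j"
    using that V1 by (simp add: V' delete_row_def delete_column_def)
qed

lemma sirup_applicable_upper_triangular:
  assumes ut: "\<And>r c. V r c \<noteq> 0 \<Longrightarrow> r \<le> c"
    and diag: "\<And>j. j \<in> set js \<Longrightarrow> V j j \<noteq> 0" and "distinct js"
  shows "sirup_applicable R V js"
proof -
  have "(\<forall>r c. snd (sirup R V us) r c \<noteq> 0 \<longrightarrow> r \<le> c) \<and>
        (\<forall>r. r \<notin> set us \<longrightarrow> snd (sirup R V us) r r = V r r)" for us
  proof (induction us rule: rev_induct)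
    case Nil
    then show ?case using ut by (simp add: sirup_def)
  next
    case (snoc j us)
    obtain R1 V1 where 1: "sirup R V us = (R1, V1)" by fastforce
    obtain R2 V2 where 2: "sirup_step j (R1, V1) = (R2, V2)" by fastforce
    have "sirup R V (us @ [j]) = (R2, V2)"
      using 1 2 by (simp add: sirup_def)
    moreover have "\<forall>r c. V1 r c \<noteq> 0 \<longrightarrow> r \<le> c" "\<forall>r. r \<notin> set us \<longrightarrow> V1 r r = V r r"
      using snoc.IH 1 by auto
    ultimately show ?case
      using sirup_step_upper_triangular[of V1 j R1 R2 V2] 2 by simp
  qed
  then show ?thesis
    using diag \<open>distinct js\<close> by (auto simp: sirup_applicable_def)
qed

end

theory Submission
  imports Defs
begin

text \<open>Processing \<open>j\<close> adds to each column in \<open>A\<close> a column in \<open>B\<close> that has not been modified yet. All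
  these columns, and column \<open>j\<close> itself, have a \<open>1\<close> in row \<open>j\<close> of \<open>V\<close>, so this row is cleared outside
  the diagonal. Hence row and column \<open>j\<close> can be deleted from \<open>R = D V\<close>, and \<open>V\<close> stays invertible;
  over \<open>\<int>\<^sub>2\<close> every invertible matrix is a product of column additions.

  Since \<open>L\<close> may be processed in any order, the intermediate matrices need not be reduced. The
  invariant is that a linear combination of columns of \<open>R\<close> that vanishes on all deleted rows (before
  their deletion) has a pivot at least as large as the pivot of every column occurring in it. Deleting
  a row preserves this because pivots of columns only decrease. For the column additions, along
  \<open>B\<close> each pivot moves to the next element, and the pivot of \<open>j\<close> moves to \<open>B\<^sub>1\<close>. At the
  end the condition on the deleted rows is vacuous, because \<open>L\<close> contains all cofaces of its elements,
  and the invariant says that the matrix is reduced.\<close>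

section \<open>Arithmetic in \<open>bit\<close> and pivots of columns\<close>

declare add_bit_eq_xor [simp del] mult_bit_eq_and [simp del]

lemma bit_add_self [simp]: "(x :: bit) + x = 0"
  by (cases x) auto

lemma bit_nonzero: "(x :: bit) \<noteq> 0 \<longleftrightarrow> x = 1"
  by (cases x) auto

lemma piv_ge_neg_one: "- 1 \<le> piv M c"
  by (simp add: piv_def)

text \<open>Finite support makes the \<open>Max\<close> in \<open>piv\<close> meaningful; the bound
  \<open>- 1 \<le> p\<close> accounts for the zero column.\<close>

lemma piv_le_iff:
  assumes "finite {r. M r c \<noteq> 0}"
  shows "piv M c \<le> p \<longleftrightarrow> - 1 \<le> p \<and> (\<forall>r. M r c \<noteq> 0 \<longrightarrow> int r \<le> p)"
proof (cases "\<forall>r. M r c = 0")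
  case True
  then show ?thesis by (simp add: piv_def)
next
  case False
  then have ne: "{r. M r c \<noteq> 0} \<noteq> {}" by auto
  define m where "m = Max {r. M r c \<noteq> 0}"
  have m: "M m c \<noteq> 0" "\<And>r. M r c \<noteq> 0 \<Longrightarrow> r \<le> m"
    using Max_in[OF assms ne] Max_ge[OF assms] by (auto simp: m_def)
  have "piv M c = int m" using False by (auto simp: piv_def m_def)
  then show ?thesis using m by force
qed

lemma int_le_piv:
  assumes "finite {r. M r c \<noteq> 0}" "M r c \<noteq> 0"
  shows "int r \<le> piv M c"
  using piv_le_iff[where M = M and c = c and p = "piv M c"] assms by auto

lemma piv_entry:
  assumes "finite {r. M r c \<noteq> 0}" "M r c \<noteq> 0"
  obtains m where "piv M c = int m" "M m c \<noteq> 0"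
proof
  show "piv M c = int (Max {r. M r c \<noteq> 0})" using assms(2) by (auto simp: piv_def)
  show "M (Max {r. M r c \<noteq> 0}) c \<noteq> 0" using Max_in[OF assms(1)] assms(2) by auto
qed

subsection \<open>Column additions and invertible matrices\<close>

definition supported_on :: "nat set \<Rightarrow> z2_matrix \<Rightarrow> bool" where
  "supported_on I M \<longleftrightarrow> (\<forall>r c. r \<notin> I \<or> c \<notin> I \<longrightarrow> M r c = 0)"

lemma supported_onD:
  "supported_on I M \<Longrightarrow> r \<notin> I \<Longrightarrow> M r c = 0"
  "supported_on I M \<Longrightarrow> c \<notin> I \<Longrightarrow> M r c = 0"
  by (simp_all add: supported_on_def)

lemma supported_on_identity_matrix: "supported_on I (identity_matrix I)"
  by (simp add: supported_on_def identity_matrix_def)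

lemma supported_on_add_column:
  "supported_on I M \<Longrightarrow> i \<in> I \<Longrightarrow> supported_on I (add_column k i M)"
  by (auto simp: supported_on_def add_column_def)

lemma supported_on_delete:
  "supported_on I M \<Longrightarrow> supported_on (I - {j}) (delete_row j (delete_column j M))"
  by (auto simp: supported_on_def delete_row_def delete_column_def)

lemma column_ops_supported_on:
  assumes "column_ops I D R V"
  shows "supported_on I V" and "supported_on I D \<Longrightarrow> supported_on I R"
  using assms
  by (induction) (auto simp: supported_on_identity_matrix supported_on_add_column)

text \<open>Over \<open>bit\<close> a coefficient vector is the set \<open>S\<close> of rows with
  coefficient 1, so this is linear independence of the rows. For a square matrix it amounts to
  invertibility, without naming an inverse.\<close>

definition independent_rows :: "nat set \<Rightarrow> z2_matrix \<Rightarrow> bool" where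
  "independent_rows I V \<longleftrightarrow> (\<forall>S\<subseteq>I. (\<forall>c\<in>I. (\<Sum>r\<in>S. V r c) = 0) \<longrightarrow> S = {})"

lemma independent_rowsD:
  "independent_rows I V \<Longrightarrow> S \<subseteq> I \<Longrightarrow> (\<And>c. c \<in> I \<Longrightarrow> (\<Sum>r\<in>S. V r c) = 0) \<Longrightarrow> S = {}"
  by (auto simp: independent_rows_def)

lemma independent_rows_add_column:
  assumes "independent_rows I V" "k \<in> I" "i \<in> I" "k \<noteq> i"
  shows "independent_rows I (add_column k i V)"
  unfolding independent_rows_def
proof (intro allI impI)
  fix S assume S: "S \<subseteq> I" "\<forall>c\<in>I. (\<Sum>r\<in>S. add_column k i V r c) = 0"
  have other: "(\<Sum>r\<in>S. V r c) = 0" if "c \<in> I" "c \<noteq> i" for c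
    using S(2) that by (auto simp: add_column_def)
  have "(\<Sum>r\<in>S. V r i) + (\<Sum>r\<in>S. V r k) = 0"
    using S(2) assms(3) by (auto simp: add_column_def sum.distrib)
  then have "(\<Sum>r\<in>S. V r i) = 0"
    using other[OF assms(2,4)] by simp
  with other show "S = {}"
    by (intro independent_rowsD[OF assms(1) S(1)]) metis
qed

lemma column_ops_independent_rows:
  assumes "column_ops I D R V" "finite I"
  shows "independent_rows I V"
  using assms(1)
proof induction
  case start
  show ?case
    unfolding independent_rows_def
  proof (intro allI impI)
    fix S assume S: "S \<subseteq> I" "\<forall>c\<in>I. (\<Sum>r\<in>S. identity_matrix I r c) = 0"
    have "(\<Sum>r\<in>S. identity_matrix I r c) = 1" if "c \<in> S" for c
    proof -
      have "(\<Sum>r\<in>S. identity_matrix I r c) = (\<Sum>r\<in>S. if r = c then 1 else 0)"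
        using S(1) by (intro sum.cong) (auto simp: identity_matrix_def)
      then show ?thesis
        using that finite_subset[OF S(1) assms(2)] by simp
    qed
    then show "S = {}" using S by fastforce
  qed
next
  case add
  then show ?case by (simp add: independent_rows_add_column)
qed

lemma add_column_twice: "k \<noteq> i \<Longrightarrow> add_column k i (add_column k i M) = M"
  by (auto simp: add_column_def fun_eq_iff add.assoc)

text \<open>An addition over \<open>bit\<close> undoes itself, so elimination may simplify
  \<open>V\<close> and be reversed afterwards. The resulting \<open>R\<close> stays existential; it
  is recovered later from the product formula.\<close>

lemma column_ops_add_column_iff:
  assumes "k \<in> I" "i \<in> I" "k \<noteq> i"
  shows "(\<exists>R. column_ops I D R (add_column k i V)) \<longleftrightarrow> (\<exists>R. column_ops I D R V)"
  using column_ops.add[OF _ assms] add_column_twice[OF assms(3)] by metis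

definition add_column_to_all :: "nat \<Rightarrow> nat set \<Rightarrow> z2_matrix \<Rightarrow> z2_matrix" where
  "add_column_to_all k X M = (\<lambda>r c. if c \<in> X then M r c + M r k else M r c)"

lemma add_column_to_all_invariants:
  assumes "finite X" "k \<in> I" "X \<subseteq> I - {k}"
  shows "((\<exists>R. column_ops I D R (add_column_to_all k X V)) \<longleftrightarrow> (\<exists>R. column_ops I D R V)) \<and>
    (independent_rows I V \<longrightarrow> independent_rows I (add_column_to_all k X V))"
  using assms
proof (induction X)
  case empty
  then show ?case by (simp add: add_column_to_all_def)
next
  case (insert i X)
  have "add_column_to_all k (insert i X) V = add_column k i (add_column_to_all k X V)"
    using insert by (auto simp: add_column_to_all_def add_column_def fun_eq_iff)
  then show ?case
    using insert independent_rows_add_column[of I "add_column_to_all k X V" k i]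
      column_ops_add_column_iff[of k I i D "add_column_to_all k X V"] by auto
qed

text \<open>Gauss-Jordan elimination; \<open>J\<close> is the set of rows that already agree with the identity.\<close>

lemma independent_rows_imp_column_ops:
  assumes "finite I" "independent_rows I V" "supported_on I V"
  shows "\<exists>R. column_ops I D R V"
proof -
  have "\<exists>R. column_ops I D R V"
    if "J \<subseteq> I" "\<forall>r\<in>J. \<forall>c. V r c = identity_matrix I r c"
      "independent_rows I V" "supported_on I V" for J V
    using that
  proof (induction "card (I - J)" arbitrary: J V)
    case 0
    have "I = J" using 0(1,2) assms(1) by auto
    then have "V r c = identity_matrix I r c" for r c
      using 0(3) supported_onD(1)[OF 0(5)] supported_onD(1)[OF supported_on_identity_matrix]
      by (cases "r \<in> I") auto
    then have "V = identity_matrix I"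
      by (simp add: fun_eq_iff)
    then show ?case using column_ops.start by metis
  next
    case (Suc d)
    have "I - J \<noteq> {}"
      using Suc.hyps(2) by force
    then obtain q where q: "q \<in> I" "q \<notin> J"
      by blast
    have idJ: "V r c = (if r = c then 1 else 0)" if "r \<in> J" for r c
      using Suc.prems(1,2) that by (auto simp: identity_matrix_def)
    \<comment> \<open>Without such a \<open>k\<close>, row \<open>q\<close> would be a sum of unit
      vectors among the rows in \<open>J\<close>, a dependency on
      \<open>insert q ?S\<close>.\<close>
    have "\<exists>k\<in>I - J. V q k \<noteq> 0"
    proof (rule ccontr)
      assume none: "\<not> ?thesis"
      let ?S = "{c \<in> J. V q c \<noteq> 0}"
      have fin: "finite ?S" using finite_subset[OF Suc.prems(1) assms(1)] by simp
      have "(\<Sum>r\<in>insert q ?S. V r c) = 0" if "c \<in> I" for c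
      proof -
        have "(\<Sum>r\<in>?S. V r c) = (\<Sum>r\<in>?S. if r = c then 1 else 0)"
          using idJ by (intro sum.cong) auto
        also have "\<dots> = V q c"
          using fin none that by (auto simp: bit_nonzero)
        finally show ?thesis using fin q by simp
      qed
      then show False
        using independent_rowsD[OF Suc.prems(3), of "insert q ?S"] q Suc.prems(1) by auto
    qed
    then obtain k where k: "k \<in> I" "k \<notin> J" "V q k \<noteq> 0" by auto
    \<comment> \<open>Column \<open>k\<close> supplies the diagonal entry if it is missing. The rows
      in \<open>J\<close> are unit vectors with a 0 in column \<open>k\<close>, so they do not
      change.\<close>
    obtain V1 where V1: "(\<exists>R. column_ops I D R V1) \<longleftrightarrow> (\<exists>R. column_ops I D R V)"
      "independent_rows I V1" "\<forall>r\<in>J. \<forall>c. V1 r c = V r c" "V1 q q = 1"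
      "supported_on I V1"
    proof (cases "V q q = 0")
      case False
      then show ?thesis using Suc.prems that[of V] by (simp add: bit_nonzero)
    next
      case True
      then have kq: "k \<noteq> q" using k by auto
      show ?thesis
      proof (rule that[of "add_column k q V"])
        show "\<forall>r\<in>J. \<forall>c. add_column k q V r c = V r c"
          using idJ k by (auto simp: add_column_def)
        show "supported_on I (add_column k q V)"
          using Suc.prems(4) q(1) by (rule supported_on_add_column)
        show "add_column k q V q q = 1"
          using k True by (simp add: add_column_def bit_nonzero)
      qed (use k q kq Suc.prems(3) in
          \<open>simp_all add: column_ops_add_column_iff independent_rows_add_column\<close>)
    qed
    \<comment> \<open>Adding column \<open>q\<close> to the columns in \<open>X\<close> clears row
      \<open>q\<close> off the diagonal; the rows in \<open>J\<close> have a 0 in column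
      \<open>q\<close>.\<close>
    define X where "X = {c. c \<noteq> q \<and> V1 q c \<noteq> 0}"
    have X: "X \<subseteq> I - {q}"
      unfolding X_def using supported_onD(2)[OF V1(5)] by blast
    have finX: "finite X"
      using X assms(1) finite_subset by blast
    let ?V2 = "add_column_to_all q X V1"
    have "\<exists>R. column_ops I D R ?V2"
    proof (rule Suc.hyps(1)[of "insert q J"])
      have "I - insert q J = (I - J) - {q}" by auto
      then show "d = card (I - insert q J)"
        using Suc.hyps(2) q assms(1) by simp
      show "insert q J \<subseteq> I" using q Suc.prems by simp
      show "\<forall>r\<in>insert q J. \<forall>c. ?V2 r c = identity_matrix I r c"
        using V1(3,4) idJ q Suc.prems(1,2)
        by (auto simp: add_column_to_all_def X_def identity_matrix_def bit_nonzero)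
      show "independent_rows I ?V2"
        using add_column_to_all_invariants[OF finX q(1) X] V1(2) by blast
      show "supported_on I ?V2"
        using V1(5) X by (auto simp: supported_on_def add_column_to_all_def)
    qed
    then show ?case
      using add_column_to_all_invariants[OF finX q(1) X] V1(1) by blast
  qed
  from this[of "{}" V] show ?thesis using assms(2,3) by simp
qed

text \<open>Row \<open>j\<close> of \<open>V\<close> is a unit vector, so removing it together with
  column \<open>j\<close> preserves invertibility, and elimination provides the additions. They lead
  to the truncated \<open>R\<close> by the product formula, in which the term for \<open>j\<close>
  vanishes.\<close>

lemma column_ops_delete:
  assumes ops: "column_ops I D R V" and I: "finite I" "j \<in> I"
    and D: "supported_on I D"
    and row: "V j j \<noteq> 0" "\<And>c. c \<noteq> j \<Longrightarrow> V j c = 0"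
  shows "column_ops (I - {j}) (delete_row j (delete_column j D))
    (delete_row j (delete_column j R)) (delete_row j (delete_column j V))"
    (is "column_ops ?I ?D ?R ?V")
proof -
  have "independent_rows ?I ?V"
    unfolding independent_rows_def
  proof (intro allI impI)
    fix S assume S: "S \<subseteq> I - {j}" "\<forall>c\<in>I - {j}. (\<Sum>r\<in>S. ?V r c) = 0"
    have fin: "finite S" and jS: "j \<notin> S"
      using S(1) I(1) finite_subset by auto
    have off: "(\<Sum>r\<in>S. V r c) = 0" if "c \<in> I" "c \<noteq> j" for c
    proof -
      have "(\<Sum>r\<in>S. V r c) = (\<Sum>r\<in>S. ?V r c)"
        using jS that by (intro sum.cong) (auto simp: delete_row_def delete_column_def)
      then show ?thesis using S(2) that by simp
    qed
    \<comment> \<open>A dependency among the remaining rows can fail only in column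
      \<open>j\<close>, and there adding row \<open>j\<close> repairs it.\<close>
    define S' where "S' = (if (\<Sum>r\<in>S. V r j) = 0 then S else insert j S)"
    have "S' = {}"
    proof (rule independent_rowsD[OF column_ops_independent_rows[OF ops I(1)]])
      show "S' \<subseteq> I" using S(1) I(2) by (auto simp: S'_def)
      show "(\<Sum>r\<in>S'. V r c) = 0" if "c \<in> I" for c
        using that off[of c] fin jS row by (cases "c = j") (auto simp: S'_def bit_nonzero)
    qed
    then show "S = {}" by (auto simp: S'_def split: if_splits)
  qed
  moreover have "supported_on ?I ?V"
    using column_ops_supported_on(1)[OF ops] by (rule supported_on_delete)
  ultimately have "\<exists>R. column_ops ?I ?D R ?V"
    using I by (intro independent_rows_imp_column_ops) blast+
  then obtain R'' where R'': "column_ops ?I ?D R'' ?V"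
    by blast
  have "R'' r c = ?R r c" for r c
  proof -
    have "R'' r c = (\<Sum>m\<in>?I. ?D r m * ?V m c)"
      using I(1) supported_onD(2)[OF supported_on_delete[OF D]]
      by (intro column_ops_product[OF R'']) auto
    also have "\<dots> = ?R r c"
    proof (cases "r = j \<or> c = j")
      case True
      then show ?thesis by (auto simp: delete_row_def delete_column_def)
    next
      case False
      have "R r c = (\<Sum>m\<in>I. D r m * V m c)"
        using I(1) supported_onD(2)[OF D] by (intro column_ops_product[OF ops]) auto
      also have "\<dots> = (\<Sum>m\<in>?I. D r m * V m c)"
        using I row(2) False by (simp add: sum.remove)
      also have "\<dots> = (\<Sum>m\<in>?I. ?D r m * ?V m c)"
        using False by (intro sum.cong) (auto simp: delete_row_def delete_column_def)
      finally show ?thesis using False by (simp add: delete_row_def delete_column_def)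
    qed
    finally show ?thesis .
  qed
  then have "R'' = ?R" by (simp add: fun_eq_iff)
  then show ?thesis using R'' by simp
qed

subsection \<open>Reducedness relative to the deleted rows\<close>

text \<open>Deleting row \<open>j\<close> before the cofaces of \<open>\<sigma> j\<close> can make two pivots coincide. What survives is
  that linear combinations of columns that vanish on all deleted rows have no cancelling pivots.
  Here \<open>F\<close> is the matrix \<open>R\<close> before any deletion of rows.\<close>

definition relatively_reduced :: "nat set \<Rightarrow> z2_matrix \<Rightarrow> z2_matrix \<Rightarrow> bool" where
  "relatively_reduced I F R \<longleftrightarrow>
     (\<forall>x. (\<forall>r. r \<notin> I \<longrightarrow> (\<Sum>i\<in>I. F r i * x i) = 0) \<longrightarrow>
       (\<forall>i\<in>I. x i \<noteq> 0 \<longrightarrow> piv R i \<le> piv (\<lambda>r _. \<Sum>i\<in>I. R r i * x i) 0))"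

lemma relatively_reducedD:
  assumes "relatively_reduced I F R" "\<And>r. r \<notin> I \<Longrightarrow> (\<Sum>i\<in>I. F r i * x i) = 0"
    and "i \<in> I" "x i \<noteq> 0"
  shows "piv R i \<le> piv (\<lambda>r _. \<Sum>i\<in>I. R r i * x i) 0"
  using assms unfolding relatively_reduced_def by blast

lemma finite_argmax:
  fixes f :: "'a \<Rightarrow> 'b :: linorder"
  assumes "finite A" "a \<in> A"
  obtains m where "m \<in> A" "\<And>i. i \<in> A \<Longrightarrow> f i \<le> f m"
proof -
  have "Max (f ` A) \<in> f ` A" using assms by (intro Max_in) auto
  then obtain m where "m \<in> A" "f m = Max (f ` A)" by auto
  then show ?thesis using assms(1) that[of m] by simp
qed

lemma finite_column_support:
  assumes "finite I" "supported_on I R"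
  shows "finite {r. R r c \<noteq> 0}"
proof (rule finite_subset[OF _ assms(1)])
  show "{r. R r c \<noteq> 0} \<subseteq> I"
    using supported_onD(1)[OF assms(2)] by blast
qed

lemma finite_combination_support:
  assumes "finite I" "supported_on I R"
  shows "finite {r. (\<Sum>i\<in>I. R r i * x i) \<noteq> 0}"
proof (rule finite_subset[OF _ assms(1)])
  show "{r. (\<Sum>i\<in>I. R r i * x i) \<noteq> 0} \<subseteq> I"
    using supported_onD(1)[OF assms(2)] by (auto intro: ccontr)
qed

text \<open>In the row of the largest pivot, no other column of the combination has an entry, since
  its pivot would be the same. So this entry survives in the sum.\<close>

lemma reduced_imp_relatively_reduced:
  assumes I: "finite I" "supported_on I R" and red: "reduced I R"
  shows "relatively_reduced I F R"
  unfolding relatively_reduced_def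
proof (intro allI impI ballI)
  fix x i assume i: "i \<in> I" "x i \<noteq> (0::bit)"
  let ?y = "\<lambda>r _. \<Sum>i\<in>I. R r i * x i"
  let ?P = "\<lambda>i. i \<in> I \<and> x i \<noteq> 0"
  have fin: "finite (Collect ?P)" using I(1) by simp
  obtain m where m: "?P m" "\<And>i. ?P i \<Longrightarrow> piv R i \<le> piv R m"
    using finite_argmax[OF fin, of i "piv R"] i by auto
  have "piv R m \<le> piv ?y 0"
  proof (cases "\<forall>r. R r m = 0")
    case True
    then show ?thesis using piv_ge_neg_one[of ?y 0] by (simp add: piv_def)
  next
    case False
    then obtain p where p: "piv R m = int p" "R p m \<noteq> 0"
      using piv_entry[where M = R and c = m] finite_column_support[OF I] by blast
    have "R p i * x i = (if i = m then 1 else 0)" if "i \<in> I" for i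
    proof (cases "i = m \<or> x i = 0 \<or> R p i = 0")
      case True
      then show ?thesis using p(2) m(1) by (auto simp: bit_nonzero)
    next
      case nz: False
      then have "piv R i \<noteq> piv R m"
        using red that m(1) p(2) unfolding reduced_def by blast
      then show ?thesis
        using nz that m(2)[of i] p(1) int_le_piv[where M = R and c = i and r = p]
          finite_column_support[OF I, of i] by auto
    qed
    then have "(\<Sum>i\<in>I. R p i * x i) = (\<Sum>i\<in>I. if i = m then 1 else 0)"
      by (rule sum.cong[OF refl])
    then have "?y p 0 \<noteq> 0" using I(1) m(1) by simp
    then show ?thesis
      using int_le_piv[where M = ?y and c = 0 and r = p] finite_combination_support[OF I] p(1) by simp
  qed
  then show "piv R i \<le> piv ?y 0" using m(2)[of i] i by simp
qed

text \<open>Two columns with equal pivots cancel in that row, so their sum has a smaller pivot. The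
  hypothesis on \<open>F\<close> makes the sum an admissible combination.\<close>

lemma relatively_reduced_imp_reduced:
  assumes I: "finite I" "supported_on I R" and red: "relatively_reduced I F R"
    and F: "\<And>r c. r \<notin> I \<Longrightarrow> c \<in> I \<Longrightarrow> F r c = 0"
  shows "reduced I R"
  unfolding reduced_def
proof (intro ballI impI notI, elim conjE)
  fix c d assume cd: "c \<in> I" "d \<in> I" "c \<noteq> d" "piv R c = piv R d"
    and nz: "\<exists>r. R r c \<noteq> 0" "\<exists>r. R r d \<noteq> 0"
  let ?x = "\<lambda>i. if i = c \<or> i = d then 1 else 0 :: bit"
  let ?y = "\<lambda>r _. \<Sum>i\<in>I. R r i * ?x i"
  have y: "?y r 0 = R r c + R r d" for r
  proof -
    have "?y r 0 = (\<Sum>i\<in>{c, d}. R r i * ?x i)"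
      using cd I(1) by (intro sum.mono_neutral_right) auto
    then show ?thesis using cd(3) by simp
  qed
  obtain p where p: "piv R c = int p" "R p c \<noteq> 0"
    using nz(1) piv_entry[where M = R and c = c] finite_column_support[OF I] by blast
  obtain q where q: "piv R d = int q" "R q d \<noteq> 0"
    using nz(2) piv_entry[where M = R and c = d] finite_column_support[OF I] by blast
  have pq: "p = q" using p(1) q(1) cd(4) by simp
  have yp: "?y p 0 = 0" using p(2) q(2) pq unfolding y by (simp add: bit_nonzero)
  have "piv R c \<le> piv ?y 0"
    using F by (intro relatively_reducedD[OF red]) (use cd in auto)
  moreover obtain m where "piv ?y 0 = int m" "?y m 0 \<noteq> 0"
  proof (rule piv_entry[where M = ?y and c = 0])
    show "finite {r. ?y r 0 \<noteq> 0}" using finite_combination_support[OF I] .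
    \<comment> \<open>A zero combination would have pivot -1, below \<open>p\<close>.\<close>
    have "\<not> (\<forall>r. ?y r 0 = 0)"
      using calculation p(1) by (auto simp: piv_def split: if_splits)
    then show "?y (SOME r. ?y r 0 \<noteq> 0) 0 \<noteq> 0" by (auto intro: someI_ex)
  qed
  ultimately have m: "p \<le> m" "?y m 0 \<noteq> 0" using p(1) by auto
  then have "m \<noteq> p" using yp by metis
  moreover have "R m c \<noteq> 0 \<or> R m d \<noteq> 0" using m(2) unfolding y by auto
  then have "m \<le> p"
    using int_le_piv[where M = R and r = m and c = c] int_le_piv[where M = R and r = m and c = d]
      finite_column_support[OF I] p(1) cd(4) by auto
  ultimately show False using m(1) by simp
qed

lemma relatively_reduced_cong:
  assumes "\<And>r c. c \<in> I \<Longrightarrow> F r c = F' r c"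
  shows "relatively_reduced I F R \<longleftrightarrow> relatively_reduced I F' R"
proof -
  have "(\<Sum>i\<in>I. F r i * x i) = (\<Sum>i\<in>I. F' r i * x i)" for r x
    using assms by (intro sum.cong) auto
  then show ?thesis by (simp add: relatively_reduced_def)
qed

text \<open>All additions read the unmodified \<open>M\<close>. By \<open>fold_sirup_add\<close>
  this is also the effect of the successive additions of SiRUP.\<close>

definition add_partners :: "(nat \<Rightarrow> nat) \<Rightarrow> nat set \<Rightarrow> z2_matrix \<Rightarrow> z2_matrix" where
  "add_partners b A M = (\<lambda>r c. if c \<in> A then M r c + M r (b c) else M r c)"

text \<open>In the application, \<open>B\<close> is the list of SiRUP and \<open>b i\<close> is the label of the column that is
  added to column \<open>i\<close>.\<close>

lemma relatively_reduced_add_partners: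
  assumes I: "finite I" "supported_on I R" and A: "A \<subseteq> I" "j \<in> I" "j \<notin> A"
    and b: "\<And>a. a \<in> A \<Longrightarrow> b a \<in> B" "B \<subseteq> insert j A"
    and out: "\<And>a. a \<in> A \<Longrightarrow> a \<notin> B \<Longrightarrow> piv R (b a) \<le> piv R a"
    and in_B: "\<And>a. a \<in> A \<Longrightarrow> a \<in> B \<Longrightarrow> piv R a < piv R (b a)"
    and inj: "inj_on b (A \<inter> B)"
    and RF: "\<And>r c. r \<in> I \<Longrightarrow> c \<in> I \<Longrightarrow> R r c = F r c"
    and red: "relatively_reduced I F R"
  shows "relatively_reduced (I - {j}) (add_partners b A F)
    (delete_row j (delete_column j (add_partners b A R)))"
    (is "relatively_reduced ?I ?F ?R")
  unfolding relatively_reduced_def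
proof (intro allI impI ballI)
  fix x' i assume ker: "\<forall>r. r \<notin> I - {j} \<longrightarrow> (\<Sum>i\<in>?I. ?F r i * x' i) = 0"
    and i: "i \<in> ?I" "x' i \<noteq> 0"
  have finA: "finite A" using A(1) I(1) by (rule finite_subset)
  define y where "y = x'(j := 0)"
  \<comment> \<open>Coefficients are pulled back along the additions: an old column occurs for
    itself and once for each column whose partner it is.\<close>
  define x where "x = (\<lambda>i. y i + (\<Sum>a\<in>{a \<in> A. b a = i}. y a))"
  have bI: "b ` A \<subseteq> I" using b A by auto
  have combination: "(\<Sum>i\<in>I. M r i * x i) = (\<Sum>i\<in>?I. add_partners b A M r i * x' i)" for M r
  proof -
    have "(\<Sum>i\<in>I. M r i * (\<Sum>a\<in>{a \<in> A. b a = i}. y a)) =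
        (\<Sum>i\<in>I. \<Sum>a\<in>{a \<in> A. b a = i}. M r (b a) * y a)"
      by (auto simp: sum_distrib_left intro!: sum.cong)
    also have "\<dots> = (\<Sum>a\<in>A. M r (b a) * y a)"
      using finA I(1) bI by (rule sum.group)
    also have "\<dots> = (\<Sum>i\<in>I. if i \<in> A then M r (b i) * y i else 0)"
      using A(1) I(1) by (simp add: sum.inter_restrict[symmetric] Int_absorb1)
    finally have "(\<Sum>i\<in>I. M r i * x i) =
        (\<Sum>i\<in>I. M r i * y i + (if i \<in> A then M r (b i) * y i else 0))"
      by (simp add: x_def distrib_left sum.distrib)
    also have "\<dots> = (\<Sum>i\<in>I. add_partners b A M r i * y i)"
      by (intro sum.cong) (auto simp: add_partners_def distrib_right)
    also have "\<dots> = (\<Sum>i\<in>?I. add_partners b A M r i * y i)"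
      using I(1) A(2) by (simp add: sum.remove y_def)
    also have "\<dots> = (\<Sum>i\<in>?I. add_partners b A M r i * x' i)"
      by (intro sum.cong) (auto simp: y_def)
    finally show ?thesis .
  qed
  \<comment> \<open>An upper bound for the pivot of the new column \<open>i\<close>: inside
    \<open>A \<inter> B\<close> the partner has the larger pivot, elsewhere column \<open>i\<close>
    dominates.\<close>
  define w where "w i = (if i \<in> A \<inter> B then piv R (b i) else piv R i)" for i
  have "supported_on I ?R"
    unfolding supported_on_def delete_row_def delete_column_def add_partners_def
    using supported_onD[OF I(2)] A(1) by auto
  note finR = finite_column_support[OF I] finite_column_support[OF I(1) this]
  have piv_w: "piv ?R i \<le> w i" if "i \<in> ?I" for i
  proof -
    have "piv R i \<le> w i" "i \<in> A \<Longrightarrow> piv R (b i) \<le> w i"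
      using in_B[of i] out[of i] by (auto simp: w_def)
    then have "int r \<le> w i" if "?R r i \<noteq> 0" for r
      using that int_le_piv[where M = R and r = r and c = i] int_le_piv[where M = R and r = r and c = "b i"] finR
      by (fastforce simp: delete_row_def delete_column_def add_partners_def split: if_splits)
    then show ?thesis
      using piv_le_iff[where M = ?R and c = i and p = "w i"] finR piv_ge_neg_one[of R i]
        piv_ge_neg_one[of R "b i"] by (auto simp: w_def)
  qed
  have x_out: "x i = x' i" if "i \<noteq> j" "i \<notin> B" for i
  proof -
    have none: "{a \<in> A. b a = i} = {}" using b that by auto
    show ?thesis unfolding x_def none using that by (simp add: y_def)
  qed
  \<comment> \<open>For \<open>m\<close> maximizing \<open>w\<close> among the new columns used,
    some old column that occurs in \<open>x\<close> has a pivot of at least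
    \<open>w m\<close>.\<close>
  obtain i0 where i0: "i0 \<in> I" "x i0 \<noteq> 0" "w i \<le> piv R i0"
  proof -
    let ?S = "{i \<in> ?I. x' i \<noteq> 0}"
    obtain m where m: "m \<in> ?S" "\<And>i. i \<in> ?S \<Longrightarrow> w i \<le> w m"
      using finite_argmax[of ?S i w] I(1) i by auto
    have "\<exists>i0\<in>I. x i0 \<noteq> 0 \<and> w m \<le> piv R i0"
    proof (cases "m \<in> A \<inter> B")
      case False
      then have "m \<notin> B" using b(2) m(1) by auto
      then show ?thesis using m(1) x_out[of m] by (auto simp: w_def)
    next
      case True
      show ?thesis
      proof (cases "\<exists>a\<in>A. a \<notin> B \<and> b a = b m \<and> x' a \<noteq> 0")
        case True
        \<comment> \<open>A column outside \<open>B\<close> keeps its coefficient in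
          \<open>x\<close>, and its pivot is at least that of its partner
          \<open>b m\<close>.\<close>
        then obtain a where a: "a \<in> A" "a \<notin> B" "b a = b m" "x' a \<noteq> 0" by auto
        then have "w m \<le> piv R a" using out[of a] \<open>m \<in> A \<inter> B\<close> by (simp add: w_def)
        then show ?thesis using a A x_out[of a] by auto
      next
        case False
        \<comment> \<open>Column \<open>b m\<close> itself has coefficient 0, as
          \<open>w (b m)\<close> would exceed the maximum. By injectivity, \<open>m\<close> alone
          contributes to \<open>x (b m)\<close>.\<close>
        have "y (b m) = 0"
        proof (rule ccontr)
          assume "y (b m) \<noteq> 0"
          then have nz: "b m \<noteq> j" "x' (b m) \<noteq> 0" by (auto simp: y_def split: if_splits)
          then have bm: "b m \<in> A \<inter> B" using b True by auto
          then have "w m < w (b m)" using in_B[of "b m"] True by (simp add: w_def)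
          then show False using m(2)[of "b m"] nz bm A(1) by auto
        qed
        moreover have "(\<Sum>a\<in>{a \<in> A. b a = b m}. y a) = (\<Sum>a\<in>{m}. y a)"
        proof (rule sum.mono_neutral_right)
          show "\<forall>a\<in>{a \<in> A. b a = b m} - {m}. y a = 0"
          proof
            fix a assume a: "a \<in> {a \<in> A. b a = b m} - {m}"
            then have "a \<notin> B" using inj_onD[OF inj, of a m] True by auto
            then show "y a = 0" using False a by (auto simp: y_def)
          qed
        qed (use finA True in auto)
        ultimately have "x (b m) \<noteq> 0"
          using m(1) by (simp add: x_def y_def)
        then show ?thesis using True bI by (auto simp: w_def)
      qed
    qed
    then show ?thesis using that m(2)[of i] i by force
  qed
  have "piv R i0 \<le> piv (\<lambda>r _. \<Sum>i\<in>I. R r i * x i) 0"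
    using red by (rule relatively_reducedD) (use ker i0 in \<open>simp_all add: combination\<close>)
  also have "(\<lambda>r (_ :: nat). \<Sum>i\<in>I. R r i * x i) = (\<lambda>r _. \<Sum>i\<in>?I. ?R r i * x' i)"
  proof (intro ext)
    fix r
    show "(\<Sum>i\<in>I. R r i * x i) = (\<Sum>i\<in>?I. ?R r i * x' i)"
    proof (cases "r = j")
      case True
      \<comment> \<open>Row \<open>j\<close> is among the rows on which the combination vanishes, so
        its deletion leaves the combination unchanged.\<close>
      have "(\<Sum>i\<in>I. R j i * x i) = (\<Sum>i\<in>I. F j i * x i)"
        using RF A(2) by (intro sum.cong) auto
      also have "\<dots> = 0" using ker combination[of F j] by simp
      finally show ?thesis using True by (simp add: delete_row_def)
    next
      case False
      then show ?thesis
        unfolding combination by (intro sum.cong) (auto simp: delete_row_def delete_column_def)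
    qed
  qed
  finally show "piv ?R i \<le> piv (\<lambda>r _. \<Sum>i\<in>?I. ?R r i * x' i) 0"
    using piv_w[OF i(1)] i0(3) by linarith
qed

subsection \<open>The columns added by SiRUP\<close>

text \<open>The search uses the matrix from before any addition for \<open>j\<close>;
  \<open>sirup_add_eq\<close> shows that the current matrix gives the same answer.\<close>

definition sirup_partner :: "z2_matrix \<Rightarrow> z2_matrix \<Rightarrow> nat \<Rightarrow> nat \<Rightarrow> nat" where
  "sirup_partner R V j i =
     (let Bs = sirup_B R V j; k = LEAST k. k < length Bs \<and> piv R (Bs ! k) \<le> piv R i
      in if i = Bs ! k then Bs ! (k - 1) else Bs ! k)"

text \<open>Since \<open>V\<close> need not be upper triangular, labels in \<open>A\<close> may lie
  below \<open>j\<close>. Order along \<open>B\<close> is therefore measured by positions in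
  \<open>j # sirup_A V j\<close>, at which the pivots attain strict record minima.\<close>

lemma sirup_B_positions:
  obtains fs where "sirup_B R V j = map ((!) (j # sirup_A V j)) fs" "sorted_wrt (<) fs"
    "\<And>f. f \<in> set fs \<Longrightarrow> f < length (j # sirup_A V j) \<and>
       (\<forall>t<f. piv R ((j # sirup_A V j) ! f) < piv R ((j # sirup_A V j) ! t))"
proof
  let ?As = "j # sirup_A V j"
  let ?fs = "filter (\<lambda>i. \<forall>t<i. piv R (?As ! i) < piv R (?As ! t)) [0..<length ?As]"
  show "sirup_B R V j = map ((!) ?As) ?fs" by (simp add: sirup_B_def Let_def)
  show "sorted_wrt (<) ?fs" by (intro sorted_wrt_filter sorted_wrt_upt)
  show "f < length ?As \<and> (\<forall>t<f. piv R (?As ! f) < piv R (?As ! t))" if "f \<in> set ?fs" for f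
    using that unfolding set_filter set_upt by simp
qed

lemma set_sirup_B: "set (sirup_B R V j) \<subseteq> insert j (set (sirup_A V j))"
proof -
  obtain fs where fs: "sirup_B R V j = map ((!) (j # sirup_A V j)) fs"
      "\<And>f. f \<in> set fs \<Longrightarrow> f < length (j # sirup_A V j)"
    by (rule sirup_B_positions[of R V j]) blast
  have "(j # sirup_A V j) ! f \<in> set (j # sirup_A V j)" if "f \<in> set fs" for f
    using fs(2)[OF that] by (rule nth_mem)
  then show ?thesis by (auto simp: fs(1))
qed

lemma sirup_B_piv_decreasing:
  assumes "k < l" "l < length (sirup_B R V j)"
  shows "piv R (sirup_B R V j ! l) < piv R (sirup_B R V j ! k)"
proof -
  obtain fs where fs: "sirup_B R V j = map ((!) (j # sirup_A V j)) fs" "sorted_wrt (<) fs"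
      "\<And>f. f \<in> set fs \<Longrightarrow> f < length (j # sirup_A V j) \<and>
        (\<forall>t<f. piv R ((j # sirup_A V j) ! f) < piv R ((j # sirup_A V j) ! t))"
    by (rule sirup_B_positions[of R V j]) blast
  have l: "l < length fs" "k < length fs" using assms by (simp_all add: fs(1))
  have "fs ! k < fs ! l" using sorted_wrt_nth_less[OF fs(2)] assms(1) l by blast
  then show ?thesis using fs(3)[OF nth_mem[OF l(1)]] l by (simp add: fs(1))
qed

text \<open>Labels to the right of \<open>i\<close> may already have been modified when \<open>i\<close> is processed; the
  search for the column to add to \<open>i\<close> never reaches them.\<close>

lemma sirup_B_search:
  assumes A: "sirup_A V j = us @ i # vs"
  obtains l where "l < length (sirup_B R V j)" "piv R (sirup_B R V j ! l) \<le> piv R i"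
    "\<And>k. k \<le> l \<Longrightarrow> sirup_B R V j ! k \<in> set (j # us @ [i])"
proof -
  let ?As = "j # sirup_A V j" and ?m = "Suc (length us)"
  obtain fs where fs: "sirup_B R V j = map ((!) ?As) fs" "sorted_wrt (<) fs"
      "\<And>f. f \<in> set fs \<Longrightarrow> f < length ?As \<and> (\<forall>t<f. piv R (?As ! f) < piv R (?As ! t))"
    by (rule sirup_B_positions[of R V j]) blast
  have m: "?m < length ?As" "?As ! ?m = i" using A by (simp_all add: nth_append)
  have upto_m: "?As ! t \<in> set (j # us @ [i])" if "t \<le> ?m" for t
  proof -
    have "?As = (j # us @ [i]) @ vs" using A by simp
    then have "?As ! t = (j # us @ [i]) ! t"
      using that by (metis length_Cons length_append_singleton less_Suc_eq_le nth_append)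
    then show ?thesis using that by (metis length_Cons length_append_singleton less_Suc_eq_le nth_mem)
  qed
  obtain t where t: "t \<le> ?m" "?As ! t \<in> set (sirup_B R V j)" "piv R (?As ! t) \<le> piv R i"
    using sirup_B_below[OF m(1), of R] m(2) by auto
  then obtain f where f: "f \<in> set fs" "?As ! f = ?As ! t" by (auto simp: fs(1))
  \<comment> \<open>Positions \<open>f\<close> and \<open>t\<close> carry the same label; if
    \<open>t < f\<close>, the record property at \<open>f\<close> would make its pivot smaller than
    itself.\<close>
  have "f \<le> t"
    using fs(3)[OF f(1)] f(2) by (metis less_irrefl not_le)
  obtain l where l: "l < length fs" "fs ! l = f" using f(1) by (metis in_set_conv_nth)
  show ?thesis
  proof (rule that[of l])
    show "l < length (sirup_B R V j)" "piv R (sirup_B R V j ! l) \<le> piv R i"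
      using l t(3) f(2) by (simp_all add: fs(1))
    show "sirup_B R V j ! k \<in> set (j # us @ [i])" if "k \<le> l" for k
    proof -
      have "fs ! k \<le> fs ! l"
        using that l(1) sorted_wrt_nth_less[OF fs(2), of k l] by (cases "k = l") auto
      then have "fs ! k \<le> ?m" using l(2) \<open>f \<le> t\<close> t(1) by linarith
      then show ?thesis using upto_m that l(1) by (simp add: fs(1))
    qed
  qed
qed

text \<open>A search that succeeds at \<open>l\<close> reads nothing beyond \<open>l\<close>. This
  transfers the search for a partner between the original and the current matrix.\<close>

lemma Least_cong_upto:
  fixes l :: nat
  assumes "\<And>k. k \<le> l \<Longrightarrow> P k \<longleftrightarrow> Q k" "P l"
  shows "(LEAST k. P k) = (LEAST k. Q k)"
proof (rule Least_equality)
  have le: "(LEAST k. Q k) \<le> l" and Q: "Q (LEAST k. Q k)"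
    using assms by (blast intro: Least_le LeastI)+
  show "P (LEAST k. Q k)" using le Q assms(1) by blast
  show "(LEAST k. Q k) \<le> k" if "P k" for k
  proof (cases "k \<le> l")
    case True
    then show ?thesis using that assms(1) by (blast intro: Least_le)
  next
    case False
    then show ?thesis using le by linarith
  qed
qed

text \<open>Pivots strictly decrease along \<open>B\<close>, so for \<open>i\<close> in
  \<open>B\<close> the search stops at \<open>i\<close> itself and the partner is its predecessor.
  In every case the partner precedes \<open>i\<close> in \<open>j # sirup_A V j\<close>, hence is
  still unmodified.\<close>

lemma sirup_partner_cases:
  fixes R :: z2_matrix
  assumes A: "sirup_A V j = us @ i # vs" and dist: "distinct (j # sirup_A V j)"
  defines "Bs \<equiv> sirup_B R V j" and "p \<equiv> sirup_partner R V j i"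
  shows "p \<in> set (j # us)" "p \<in> set Bs"
    "i \<notin> set Bs \<Longrightarrow> piv R p \<le> piv R i"
    "i \<in> set Bs \<Longrightarrow> \<exists>k. Suc k < length Bs \<and> i = Bs ! Suc k \<and> p = Bs ! k"
proof -
  obtain l where l: "l < length Bs" "piv R (Bs ! l) \<le> piv R i"
      "\<And>k. k \<le> l \<Longrightarrow> Bs ! k \<in> set (j # us @ [i])"
    unfolding Bs_def by (rule sirup_B_search[OF A, of R]) blast
  let ?P = "\<lambda>k. k < length Bs \<and> piv R (Bs ! k) \<le> piv R i"
  define k where "k = (LEAST k. ?P k)"
  have k: "?P k" "k \<le> l" "\<And>k'. ?P k' \<Longrightarrow> k \<le> k'"
    unfolding k_def using l LeastI[of ?P l] Least_le[of ?P] by auto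
  have p: "p = (if i = Bs ! k then Bs ! (k - 1) else Bs ! k)"
    by (simp add: p_def sirup_partner_def Bs_def k_def Let_def)
  have dec: "piv R (Bs ! m) < piv R (Bs ! m')" if "m' < m" "m < length Bs" for m m'
    using sirup_B_piv_decreasing that unfolding Bs_def by blast
  \<comment> \<open>If \<open>k < m\<close>, then \<open>Bs ! m\<close>, which is \<open>i\<close>,
    would have a smaller pivot than \<open>Bs ! k\<close>, contrary to the choice of
    \<open>k\<close>.\<close>
  have i_pos: "k = m" if "m < length Bs" "i = Bs ! m" for m
    using k(1) k(3)[of m] dec[of k m] that by (cases "k < m") auto
  have "Bs ! 0 = j" using sirup_B_0 by (simp add: Bs_def)
  \<comment> \<open>Position 0 holds \<open>j\<close>, which is not in \<open>A\<close>, so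
    \<open>k - 1\<close> is a true predecessor.\<close>
  then have k0: "k \<noteq> 0" if "i = Bs ! k" using that dist A by auto
  have pi: "p \<noteq> i"
  proof (cases "i = Bs ! k")
    case True
    then show ?thesis using p k0 dec[of "k - 1" k] k(1) by auto
  qed (use p in auto)
  have "p \<in> set (j # us @ [i])" using p l(3)[of k] l(3)[of "k - 1"] k(2) by (simp split: if_splits)
  then show "p \<in> set (j # us)" using pi by auto
  show "p \<in> set Bs" using p k(1) nth_mem[of k Bs] nth_mem[of "k - 1" Bs] by (auto split: if_splits)
  show "piv R p \<le> piv R i" if "i \<notin> set Bs" using p k(1) that by auto
  show "\<exists>k. Suc k < length Bs \<and> i = Bs ! Suc k \<and> p = Bs ! k" if "i \<in> set Bs"
  proof -
    have "i = Bs ! k" using that i_pos by (metis in_set_conv_nth)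
    then show ?thesis using p k0 k(1) by (intro exI[of _ "k - 1"]) auto
  qed
qed

lemma sirup_add_eq:
  assumes A: "sirup_A V0 j = us @ i # vs"
    and R: "\<And>r c. c \<in> set (j # us @ [i]) \<Longrightarrow> R r c = R0 r c"
  shows "sirup_add (sirup_B R0 V0 j) i (R, V) =
    (add_column (sirup_partner R0 V0 j i) i R, add_column (sirup_partner R0 V0 j i) i V)"
proof -
  let ?Bs = "sirup_B R0 V0 j"
  obtain l where l: "l < length ?Bs" "piv R0 (?Bs ! l) \<le> piv R0 i"
      "\<And>k. k \<le> l \<Longrightarrow> ?Bs ! k \<in> set (j # us @ [i])"
    by (rule sirup_B_search[OF A, of R0]) blast
  have piv: "piv R c = piv R0 c" if "c \<in> set (j # us @ [i])" for c
    using R[OF that] by (simp add: piv_def)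
  have "(LEAST k. k < length ?Bs \<and> piv R0 (?Bs ! k) \<le> piv R0 i) =
      (LEAST k. k < length ?Bs \<and> piv R (?Bs ! k) \<le> piv R i)"
    by (rule Least_cong_upto[of l]) (use l piv in auto)
  then show ?thesis by (simp add: sirup_add_def sirup_partner_def Let_def)
qed

text \<open>Here \<open>vs\<close> is the part of \<open>A\<close> already processed. Partners of
  the remaining labels lie outside it, so successive additions act like simultaneous ones.\<close>

lemma fold_sirup_add:
  fixes R :: z2_matrix
  assumes dist: "distinct (j # sirup_A V j)" and A: "sirup_A V j = us @ vs"
  defines "b \<equiv> sirup_partner R V j" and "A \<equiv> set (sirup_A V j)"
  shows "fold (sirup_add (sirup_B R V j)) (rev us) (add_partners b (set vs) R, add_partners b (set vs) V) =
    (add_partners b A R, add_partners b A V)"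
  using A
proof (induction us arbitrary: vs rule: rev_induct)
  case Nil
  then show ?case by (simp add: A_def)
next
  case (snoc i us)
  then have A: "sirup_A V j = us @ i # vs" by simp
  have unmodified: "add_partners b (set vs) M r c = M r c" if "c \<in> set (j # us @ [i])" for M r c
    using that dist A by (auto simp: add_partners_def)
  have "b i \<in> set (j # us)"
    using sirup_partner_cases(1)[OF A dist] by (simp add: b_def)
  then have add: "add_column (b i) i (add_partners b (set vs) M) = add_partners b (set (i # vs)) M" for M
    using dist A by (auto simp: add_column_def add_partners_def fun_eq_iff)
  have "sirup_add (sirup_B R V j) i (add_partners b (set vs) R, add_partners b (set vs) V) =
      (add_partners b (set (i # vs)) R, add_partners b (set (i # vs)) V)"
    using sirup_add_eq[OF A, of "add_partners b (set vs) R" R] unmodified add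
    by (simp only: b_def[symmetric])
  then show ?case
    using snoc.IH[OF A] by simp
qed

lemma column_ops_add_partners:
  fixes R :: z2_matrix
  assumes dist: "distinct (j # sirup_A V j)" and A: "sirup_A V j = us @ vs"
    and I: "j \<in> I" "set (sirup_A V j) \<subseteq> I"
  defines "b \<equiv> sirup_partner R V j"
  assumes ops: "column_ops I D R V"
  shows "column_ops I D (add_partners b (set vs) R) (add_partners b (set vs) V)"
  using A
proof (induction vs arbitrary: us)
  case Nil
  then show ?case using ops by (simp add: add_partners_def)
next
  case (Cons i vs)
  have bi: "b i \<in> set (j # us)"
    using sirup_partner_cases(1)[OF Cons.prems dist] by (simp add: b_def)
  then have "add_partners b (set (i # vs)) M = add_column (b i) i (add_partners b (set vs) M)" for M
    using dist Cons.prems by (auto simp: add_column_def add_partners_def fun_eq_iff)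
  moreover have "b i \<in> I" "i \<in> I" "b i \<noteq> i"
    using bi dist Cons.prems I by auto
  ultimately show ?case
    using column_ops.add[OF Cons.IH[of "us @ [i]"]] Cons.prems by simp
qed

subsection \<open>The invariant of SiRUP\<close>

definition submatrix :: "nat set \<Rightarrow> z2_matrix \<Rightarrow> z2_matrix" where
  "submatrix I D = (\<lambda>r c. if r \<in> I \<and> c \<in> I then D r c else 0)"

lemma supported_on_submatrix: "supported_on I (submatrix I D)"
  by (simp add: supported_on_def submatrix_def)

lemma boundary_matrix_submatrix:
  "J \<subseteq> I \<Longrightarrow> boundary_matrix J \<sigma> = submatrix J (boundary_matrix I \<sigma>)"
  by (auto simp: submatrix_def boundary_matrix_def fun_eq_iff)

text \<open>The row index is unrestricted: with \<open>D\<close> the original boundary matrix, the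
  rows outside \<open>I\<close> record what the deleted rows of \<open>R\<close> would
  contain.\<close>

definition column_product :: "nat set \<Rightarrow> z2_matrix \<Rightarrow> z2_matrix \<Rightarrow> z2_matrix" where
  "column_product I D V = (\<lambda>r c. \<Sum>m\<in>I. D r m * V m c)"

definition sirup_invariant :: "nat set \<Rightarrow> z2_matrix \<Rightarrow> z2_matrix \<Rightarrow> z2_matrix \<Rightarrow> bool" where
  "sirup_invariant I D R V \<longleftrightarrow>
     column_ops I (submatrix I D) R V \<and> relatively_reduced I (column_product I D V) R"

lemma column_ops_submatrix_product:
  assumes "column_ops I (submatrix I D) R V" "finite I" "r \<in> I"
  shows "R r c = column_product I D V r c"
proof -
  have "R r c = (\<Sum>m\<in>I. submatrix I D r m * V m c)"
    using assms(2) by (intro column_ops_product[OF assms(1)]) (auto simp: submatrix_def)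
  then show ?thesis
    using assms(3) by (auto simp: column_product_def submatrix_def intro!: sum.cong)
qed

lemma column_product_add_partners:
  "column_product I D (add_partners b A V) = add_partners b A (column_product I D V)"
  by (auto simp: column_product_def add_partners_def fun_eq_iff distrib_left sum.distrib)

lemma sirup_step_invariant:
  assumes inv: "sirup_invariant I D R V" and I: "finite I" "j \<in> I"
    and diag: "V j j \<noteq> 0"
    and step: "sirup_step j (R, V) = (R', V')"
  shows "sirup_invariant (I - {j}) D R' V'"
proof -
  have ops: "column_ops I (submatrix I D) R V"
    and red: "relatively_reduced I (column_product I D V) R"
    using inv by (simp_all add: sirup_invariant_def)
  note supp = column_ops_supported_on(1)[OF ops]
    column_ops_supported_on(2)[OF ops supported_on_submatrix]
  have sub: "{i. V j i \<noteq> 0 \<and> i \<noteq> j} \<subseteq> I" using supported_onD(2)[OF supp(1)] by blast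
  then have "finite {i. V j i \<noteq> 0 \<and> i \<noteq> j}" using I(1) by (rule finite_subset)
  then have set_A: "set (sirup_A V j) = {i. V j i \<noteq> 0 \<and> i \<noteq> j}" and dist: "distinct (j # sirup_A V j)"
    by (simp_all add: sirup_A_def)
  define A where "A = set (sirup_A V j)"
  define B where "B = set (sirup_B R V j)"
  define b where "b = sirup_partner R V j"
  let ?R1 = "add_partners b A R" and ?V1 = "add_partners b A V"
  have "fold (sirup_add (sirup_B R V j)) (rev (sirup_A V j)) (R, V) = (?R1, ?V1)"
    using fold_sirup_add[OF dist, of "sirup_A V j" "[]" R] by (simp add: A_def b_def add_partners_def)
  then have R': "R' = delete_row j (delete_column j ?R1)" and V': "V' = delete_row j (delete_column j ?V1)"
    using step by (simp_all add: sirup_step_def)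
  have cases: "b a \<in> B" "a \<notin> B \<Longrightarrow> piv R (b a) \<le> piv R a"
    "a \<in> B \<Longrightarrow> \<exists>k. Suc k < length (sirup_B R V j) \<and> a = sirup_B R V j ! Suc k \<and> b a = sirup_B R V j ! k"
    if "a \<in> A" for a
  proof -
    obtain us vs where "sirup_A V j = us @ a # vs"
      using \<open>a \<in> A\<close> split_list unfolding A_def by fast
    from sirup_partner_cases[OF this dist, of R]
    show "b a \<in> B" "a \<notin> B \<Longrightarrow> piv R (b a) \<le> piv R a"
      "a \<in> B \<Longrightarrow> \<exists>k. Suc k < length (sirup_B R V j) \<and> a = sirup_B R V j ! Suc k \<and> b a = sirup_B R V j ! k"
      by (simp_all add: b_def B_def)
  qed
  have B: "B \<subseteq> insert j A" using set_sirup_B by (auto simp: A_def B_def)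
  have A: "A \<subseteq> I" "j \<notin> A" using sub set_A by (auto simp: A_def)
  have "column_ops I (submatrix I D) ?R1 ?V1"
    using column_ops_add_partners[of j V "[]" "sirup_A V j" I _ R] dist I(2) A(1) ops
    by (simp add: A_def b_def)
  \<comment> \<open>Column \<open>c\<close> and its partner both have a 1 in row \<open>j\<close>,
    so they cancel. If the partner is \<open>j\<close> itself, this relies on
    \<open>diag\<close>.\<close>
  moreover have row_j: "?V1 j c = 0" if "c \<noteq> j" for c
  proof (cases "c \<in> A")
    case True
    then have "b c \<in> insert j A" using cases(1) B by blast
    then have "V j (b c) = 1" using diag set_A by (auto simp: A_def bit_nonzero)
    then show ?thesis using True set_A by (simp add: add_partners_def A_def bit_nonzero)
  next
    case False
    then show ?thesis using that set_A by (auto simp: add_partners_def A_def)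
  qed
  moreover have "?V1 j j \<noteq> 0" using diag A(2) by (simp add: add_partners_def)
  ultimately have "column_ops (I - {j}) (delete_row j (delete_column j (submatrix I D))) R' V'"
    unfolding R' V' using I by (intro column_ops_delete supported_on_submatrix) auto
  moreover have "delete_row j (delete_column j (submatrix I D)) = submatrix (I - {j}) D"
    by (auto simp: delete_row_def delete_column_def submatrix_def fun_eq_iff)
  moreover have "relatively_reduced (I - {j}) (add_partners b A (column_product I D V)) R'"
    unfolding R'
  proof (rule relatively_reduced_add_partners[where B = B])
    show "piv R a < piv R (b a)" if "a \<in> A" "a \<in> B" for a
      using cases(3)[OF that] sirup_B_piv_decreasing[of _ _ R V j] by auto
    \<comment> \<open>On \<open>A \<inter> B\<close> the map \<open>b\<close> is the shift to the
      predecessor in \<open>B\<close>, whose entries are distinct because their pivots are.\<close>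
    show "inj_on b (A \<inter> B)"
    proof (rule inj_onI)
      fix a a' assume a: "a \<in> A \<inter> B" "a' \<in> A \<inter> B" "b a = b a'"
      obtain k where k: "Suc k < length (sirup_B R V j)" "a = sirup_B R V j ! Suc k" "b a = sirup_B R V j ! k"
        using cases(3)[of a] a by blast
      obtain k' where k': "Suc k' < length (sirup_B R V j)" "a' = sirup_B R V j ! Suc k'" "b a' = sirup_B R V j ! k'"
        using cases(3)[of a'] a by blast
      have "\<not> k < k'" "\<not> k' < k"
        using sirup_B_piv_decreasing[of k k' R V j] sirup_B_piv_decreasing[of k' k R V j] k k' a(3)
        by auto
      then have "k = k'" by simp
      then show "a = a'" using k k' by simp
    qed
    show "R r c = column_product I D V r c" if "r \<in> I" for r c
      using column_ops_submatrix_product[OF ops I(1) that] .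
  qed (use I A B cases supp red in auto)
  \<comment> \<open>By \<open>row_j\<close> the term for \<open>m = j\<close> vanishes, so
    truncating \<open>V\<close> does not affect the product on the remaining columns.\<close>
  moreover have product: "column_product (I - {j}) D V' r c = add_partners b A (column_product I D V) r c"
    if "c \<in> I - {j}" for r c
  proof -
    have "column_product (I - {j}) D V' r c = (\<Sum>m\<in>I - {j}. D r m * ?V1 m c)"
      unfolding column_product_def V'
      using that by (intro sum.cong) (auto simp: delete_row_def delete_column_def)
    also have "\<dots> = column_product I D ?V1 r c"
      using that I row_j by (simp add: column_product_def sum.remove)
    finally show ?thesis by (simp add: column_product_add_partners)
  qed
  moreover note relatively_reduced_cong[where I = "I - {j}" and R = R', OF product]
  ultimately show ?thesis
    by (simp add: sirup_invariant_def)
qed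

lemma sirup_invariant_sirup:
  assumes "sirup_invariant I D R V" "finite I" "distinct js" "set js \<subseteq> I"
    and "sirup_applicable R V js"
  shows "sirup_invariant (I - set js) D (fst (sirup R V js)) (snd (sirup R V js))"
  using assms(3-5)
proof (induction js rule: rev_induct)
  case Nil
  then show ?case using assms(1) by (simp add: sirup_def)
next
  case (snoc j js)
  obtain R1 V1 where 1: "sirup R V js = (R1, V1)" by fastforce
  obtain R2 V2 where 2: "sirup_step j (R1, V1) = (R2, V2)" by fastforce
  have "sirup_applicable R V js"
    using snoc.prems(3) by (auto simp: sirup_applicable_def)
  moreover have "snd (sirup R V js) j j \<noteq> 0"
    using snoc.prems(3) unfolding sirup_applicable_def by blast
  ultimately have "sirup_invariant (I - set js - {j}) D R2 V2"
    using snoc 1 assms(2) by (intro sirup_step_invariant[OF _ _ _ _ 2]) auto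
  moreover have "sirup R V (js @ [j]) = (R2, V2)" using 1 2 by (simp add: sirup_def)
  moreover have "I - set (js @ [j]) = I - set js - {j}" by auto
  ultimately show ?case by simp
qed

theorem theorem3p4:
  fixes K T L :: "'v set set" and n :: nat and \<sigma> :: "nat \<Rightarrow> 'v set"
    and R' V' R V :: z2_matrix and js :: "nat list"
  assumes "simplicial_complex K"
    and "filtration K {1..n} \<sigma>"
    and "T \<subseteq> K"
    and "L = (\<Union>\<tau>\<in>T. star K \<tau>)"
    and "distinct js" and "set js = {j \<in> {1..n}. \<sigma> j \<in> L}"
    and "reduced_and_operations_matrix {1..n} \<sigma> R' V'"
    and "sirup_applicable R' V' js"
    and "sirup R' V' js = (R, V)"
  shows "reduced_and_operations_matrix (labels_without {1..n} \<sigma> L) \<sigma> R V"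
proof -
  define I where "I = {1..n}"
  define D where "D = boundary_matrix I \<sigma>"
  define J where "J = labels_without I \<sigma> L"
  have J: "J = I - set js" "J \<subseteq> I" "finite J"
    unfolding assms(6) J_def I_def labels_without_def by auto
  have D: "submatrix I D = boundary_matrix I \<sigma>"
    unfolding D_def by (rule boundary_matrix_submatrix[symmetric]) simp
  have ops: "column_ops I (submatrix I D) R' V'" and red: "reduced I R'"
    using assms(7) unfolding D by (simp_all add: reduced_and_operations_matrix_def I_def)
  have "sirup_invariant I D R' V'"
    unfolding sirup_invariant_def
    using ops red column_ops_supported_on(2)[OF ops supported_on_submatrix]
    by (simp add: reduced_imp_relatively_reduced I_def)
  moreover have "finite I" "set js \<subseteq> I"
    unfolding assms(6) I_def by auto
  ultimately have "sirup_invariant J D R V"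
    using sirup_invariant_sirup[of I D R' V' js] assms(5,8,9) by (simp add: J(1))
  then have final: "column_ops J (submatrix J D) R V" "relatively_reduced J (column_product J D V) R"
    by (simp_all add: sirup_invariant_def)
  \<comment> \<open>A deleted facet lies in \<open>L\<close>, and \<open>L\<close> is closed under
    cofaces, so a surviving column has no entry in a deleted row.\<close>
  have "D r m = 0" if "r \<notin> J" "m \<in> J" for r m
  proof (rule ccontr)
    assume "D r m \<noteq> 0"
    then have rm: "r \<in> I" "m \<in> I" "\<sigma> r \<subseteq> \<sigma> m"
      by (auto simp: D_def boundary_matrix_def is_facet_def split: if_splits)
    then have "\<sigma> r \<in> L" using that(1) by (simp add: J_def labels_without_def)
    moreover have "\<sigma> m \<in> K"
      using assms(2) rm(2) unfolding filtration_def I_def by (blast intro: bij_betw_apply)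
    ultimately have "\<sigma> m \<in> L" using rm(3) by (auto simp: assms(4) star_def)
    then show False using that(2) by (simp add: J_def labels_without_def)
  qed
  then have "column_product J D V r c = 0" if "r \<notin> J" for r c
    using that by (simp add: column_product_def)
  then have "reduced J R"
    using relatively_reduced_imp_reduced[OF J(3) _ final(2)]
      column_ops_supported_on(2)[OF final(1) supported_on_submatrix] by blast
  moreover have "submatrix J D = boundary_matrix J \<sigma>"
    unfolding D_def using J(2) by (rule boundary_matrix_submatrix[symmetric])
  ultimately show ?thesis
    using final(1) by (simp add: reduced_and_operations_matrix_def J_def I_def)
qed

end
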